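(* Let $\mathcal{X}_h=(X,U,f,h,Y)$ be an external system, let $\pi_{hist}$ be a feasible policy over its attainable histories, and let $(Y^{<\mathbb{N}},Y,\phi_{\tilde Y},(),\pi,U^\xi)$ be the restriction of the history ITS by $\pi_{hist}$. An ITS $S=(\mathcal{I},Y,\phi,\iota_0)$ supports $\pi_{hist}$ if and only if $S$ is the quotient of $(Y^{<\mathbb{N}},Y,\phi_{\tilde Y},())$ by some sufficient labeling function $\kappa$ satisfying $\kappa\succeq\pi$.
   Context: External system: $\mathcal{X}_h=(X,U,f,h,Y)$ consists of a state set $X$, an action set $U$, a transition function $f:X\times U\to X$, an observation set $Y$ and a sensor mapping $h:X\to Y$. Histories: $\mathcal{I}_{hist}$ is the set of finite alternating sequences $\eta=(y_1,u_1,y_2,\dots,u_{N-1},y_N)$ with $y_i\in Y$, $u_i\in U$, including the empty history $()$ (the first step appends just $y_1$; every later step appends a pair $(u,y)$). A history $\eta$ is attainable if it is empty or there is $x_1\in X$ such that, with $x_{k+1}=f(x_k,u_k)$, one has $y_k=h(x_k)$ for all $k\le N$. $\mathcal{I}_{hist}^{\mathcal{X}_h}$ denotes the set of attainable histories. Policies and feasibility: a task is a function $\kappa_{task}:\mathcal{I}_{hist}\to\{0,1\}$. A policy over histories is a function $\pi_{hist}:\mathcal{I}_{hist}^{\mathcal{X}_h}\to U$. It is feasible if for every $x_1\in X$ the history $(h(x_1),u_1,h(x_2),\dots,u_{N-1},h(x_N))$ generated by $u_k=\pi_{hist}(h(x_1),u_1,\dots,h(x_k))$, $x_{k+1}=f(x_k,u_k)$,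 lies in $\kappa_{task}^{-1}(1)$ for some $N$ (which may depend on $x_1$). Restriction of the history ITS by $\pi_{hist}$: $Y^{<\mathbb{N}}$ is the set of finite sequences over $Y$, $\phi_{\tilde Y}(\tilde y,y)=\tilde y^\frown y$ (concatenation), $U^\xi=U\cup\{\xi\}$ with $\xi\notin U$ a dummy label marking unattainability. The labeling $\pi:Y^{<\mathbb{N}}\to U^\xi$ is defined as follows: $\pi(())=\pi_{hist}(())$; for $\tilde y=(y_1,\dots,y_N)$, $N\ge1$, form the history $\eta=(y_1,u_1,\dots,u_{N-1},y_N)$ with $u_k=\pi_{hist}(y_1,u_1,\dots,y_k)$ as long as the prefixes $(y_1,u_1,\dots,y_k)$ are attainable; if all prefixes including $\eta$ itself are attainable put $\pi(\tilde y)=\pi_{hist}(\eta)$, otherwise put $\pi(\tilde y)=\xi$. ITS: an information transition system (ITS) $S=(\mathcal{I},Y,\phi,\iota_0)$ consists of a state set $\mathcal{I}$, the edge-label set $Y$, a function $\phi:\mathcal{I}\times Y\to\mathcal{I}$ and an initial state $\iota_0\in\mathcal{I}$. For $\mu:\mathcal{I}\to U^\xi$ define $\Pi(S,\mu):Y^{<\mathbb{N}}\to U^\xi$ by $\Pi(S,\mu)(y_1,\dots,y_N)=\mu(\iota_N)$, where $\iota_i=\phi(\iota_{i-1},y_i)$ (for $N=0$ the value is $\mu(\iota_0)$). $S$ supports $\pi_{hist}$ if there is $\mu:\mathcal{I}\to U^\xi$ with $\Pi(S,\mu)=\pi$. Labelings: for labeling functions $\kappa,\kappa'$ on the same set, $\kappa'\succeq\kappa$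 ($\kappa'$ is a refinement of $\kappa$) means every fiber of $\kappa'$ is contained in a fiber of $\kappa$. A labeling $\kappa$ of $Y^{<\mathbb{N}}$ is sufficient if $\kappa(\tilde y)=\kappa(\tilde y')$ implies $\kappa(\tilde y^\frown y)=\kappa(\tilde y'^\frown y)$ for all $y\in Y$. For sufficient $\kappa$, the quotient of $(Y^{<\mathbb{N}},Y,\phi_{\tilde Y},())$ by $\kappa$ is the ITS whose states are the classes $[\tilde y]_\kappa$ (fibers of $\kappa$), with transitions $([\tilde y]_\kappa,y)\mapsto[\tilde y^\frown y]_\kappa$ and initial state $[()]_\kappa$; a class $[\tilde y]_\kappa$ is identified with its label $\kappa(\tilde y)\in\mathcal{I}$.
   Formalization: "S is the quotient" is read as: the part of S reachable from its initial state is the quotient (classes identified with labels). Read literally, "only if" fails for an ITS that supports the policy but has an extra unreachable state, since all states of a quotient are reachable. *)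

theory Defs
  imports Main
begin

text \<open>
  An external system is given by its transition function \<open>f :: 'x \<Rightarrow> 'u \<Rightarrow> 'x\<close> and its sensor mapping
  \<open>h :: 'x \<Rightarrow> 'y\<close>; the sets of states, actions and observations are the types \<open>'x\<close>, \<open>'u\<close>, \<open>'y\<close>.
\<close>

text \<open>\<open>Hist y\<^sub>1 [(u\<^sub>1, y\<^sub>2), \<dots>, (u\<^bsub>N-1\<^esub>, y\<^sub>N)]\<close> is the history \<open>(y\<^sub>1, u\<^sub>1, y\<^sub>2, \<dots>, u\<^bsub>N-1\<^esub>, y\<^sub>N)\<close>.\<close>

datatype ('y, 'u) hist = EmptyHist | Hist 'y "('u \<times> 'y) list"

text \<open>The first step from the empty history discards the action.\<close>

fun hist_step :: "('y, 'u) hist \<Rightarrow> 'u \<Rightarrow> 'y \<Rightarrow> ('y, 'u) hist" where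
  "hist_step EmptyHist u y = Hist y []"
| "hist_step (Hist y1 ps) u y = Hist y1 (ps @ [(u, y)])"

text \<open>\<open>foldl f x1 [u\<^sub>1, \<dots>, u\<^sub>k]\<close> is the external state \<open>x\<^bsub>k+1\<^esub>\<close>.\<close>

fun attainable :: "('x \<Rightarrow> 'u \<Rightarrow> 'x) \<Rightarrow> ('x \<Rightarrow> 'y) \<Rightarrow> ('y, 'u) hist \<Rightarrow> bool" where
  "attainable f h EmptyHist \<longleftrightarrow> True"
| "attainable f h (Hist y1 ps) \<longleftrightarrow>
     (\<exists>x1. h x1 = y1 \<and>
        (\<forall>k<length ps. h (foldl f x1 (map fst (take (Suc k) ps))) = snd (ps ! k)))"

text \<open>
  Policies over histories are total functions in HOL; below they are only ever evaluated, to any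
  effect, on attainable histories.
  The pair \<open>closed_loop f h p x1 n\<close> consists of the state \<open>x\<^sub>N\<close> and the history
  \<open>(h x\<^sub>1, u\<^sub>1, \<dots>, u\<^bsub>N-1\<^esub>, h x\<^sub>N)\<close> for \<open>N = n + 1\<close>.
\<close>

primrec closed_loop ::
  "('x \<Rightarrow> 'u \<Rightarrow> 'x) \<Rightarrow> ('x \<Rightarrow> 'y) \<Rightarrow> (('y, 'u) hist \<Rightarrow> 'u) \<Rightarrow> 'x \<Rightarrow> nat \<Rightarrow> 'x \<times> ('y, 'u) hist" where
  "closed_loop f h p x1 0 = (x1, Hist (h x1) [])"
| "closed_loop f h p x1 (Suc n) =
     (let (x, \<eta>) = closed_loop f h p x1 n; u = p \<eta>; x' = f x u
      in (x', hist_step \<eta> u (h x')))"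

definition feasible ::
  "('x \<Rightarrow> 'u \<Rightarrow> 'x) \<Rightarrow> ('x \<Rightarrow> 'y) \<Rightarrow> (('y, 'u) hist \<Rightarrow> bool) \<Rightarrow> (('y, 'u) hist \<Rightarrow> 'u) \<Rightarrow> bool" where
  "feasible f h task p \<longleftrightarrow> (\<forall>x1. \<exists>n. task (snd (closed_loop f h p x1 n)))"

text \<open>The history \<open>(y\<^sub>1, u\<^sub>1, \<dots>, u\<^bsub>N-1\<^esub>, y\<^sub>N)\<close> with \<open>u\<^sub>k = p (y\<^sub>1, u\<^sub>1, \<dots>, y\<^sub>k)\<close>.\<close>

definition policy_hist :: "(('y, 'u) hist \<Rightarrow> 'u) \<Rightarrow> 'y list \<Rightarrow> ('y, 'u) hist" where
  "policy_hist p ys = foldl (\<lambda>\<eta> y. hist_step \<eta> (p \<eta>) y) EmptyHist ys"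

text \<open>
  The labeling of observation sequences in the restriction of the history ITS by \<open>p\<close>. The label
  set \<open>U \<union> {\<xi>}\<close> is \<open>'u option\<close>, with \<open>None\<close> as the dummy label \<open>\<xi>\<close>.
\<close>

definition restriction_label ::
  "('x \<Rightarrow> 'u \<Rightarrow> 'x) \<Rightarrow> ('x \<Rightarrow> 'y) \<Rightarrow> (('y, 'u) hist \<Rightarrow> 'u) \<Rightarrow> 'y list \<Rightarrow> 'u option" where
  "restriction_label f h p ys =
     (if \<forall>k\<le>length ys. attainable f h (policy_hist p (take k ys))
      then Some (p (policy_hist p ys)) else None)"

record ('i, 'y) its =
  its_states :: "'i set"
  its_step :: "'i \<Rightarrow> 'y \<Rightarrow> 'i"
  its_init :: 'i

definition is_its :: "('i, 'y) its \<Rightarrow> bool" where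
  "is_its S \<longleftrightarrow> its_init S \<in> its_states S \<and>
     (\<forall>i\<in>its_states S. \<forall>y. its_step S i y \<in> its_states S)"

definition its_run :: "('i, 'y) its \<Rightarrow> 'y list \<Rightarrow> 'i" where
  "its_run S ys = foldl (its_step S) (its_init S) ys"

definition its_policy :: "('i, 'y) its \<Rightarrow> ('i \<Rightarrow> 'u option) \<Rightarrow> 'y list \<Rightarrow> 'u option" where
  "its_policy S \<mu> ys = \<mu> (its_run S ys)"

definition supports ::
  "('x \<Rightarrow> 'u \<Rightarrow> 'x) \<Rightarrow> ('x \<Rightarrow> 'y) \<Rightarrow> (('y, 'u) hist \<Rightarrow> 'u) \<Rightarrow> ('i, 'y) its \<Rightarrow> bool" where
  "supports f h p S \<longleftrightarrow> (\<exists>\<mu>. its_policy S \<mu> = restriction_label f h p)"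

definition fiber :: "('a \<Rightarrow> 'b) \<Rightarrow> 'a \<Rightarrow> 'a set" where
  "fiber \<kappa> a = \<kappa> -` {\<kappa> a}"

definition refines :: "('a \<Rightarrow> 'b) \<Rightarrow> ('a \<Rightarrow> 'c) \<Rightarrow> bool" where
  "refines \<kappa>' \<kappa> \<longleftrightarrow> (\<forall>F\<in>range (fiber \<kappa>'). \<exists>G\<in>range (fiber \<kappa>). F \<subseteq> G)"

definition sufficient :: "('y list \<Rightarrow> 'l) \<Rightarrow> bool" where
  "sufficient \<kappa> \<longleftrightarrow>
     (\<forall>ys ys' y. \<kappa> ys = \<kappa> ys' \<longrightarrow> \<kappa> (ys @ [y]) = \<kappa> (ys' @ [y]))"

text \<open>
  The quotient of the ITS of finite observation sequences (step: append, initial state: the empty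
  sequence) by \<open>\<kappa>\<close>. The argument of \<open>the_elem\<close> is a singleton when \<open>\<kappa>\<close> is sufficient, see
  \<open>its_step_quotient\<close>.
\<close>

definition quotient_its :: "('y list \<Rightarrow> 'l) \<Rightarrow> ('y list set, 'y) its" where
  "quotient_its \<kappa> =
     \<lparr> its_states = range (fiber \<kappa>),
       its_step = (\<lambda>C y. the_elem ((\<lambda>ys. fiber \<kappa> (ys @ [y])) ` C)),
       its_init = fiber \<kappa> [] \<rparr>"

lemma its_step_quotient:
  assumes "sufficient \<kappa>"
  shows "its_step (quotient_its \<kappa>) (fiber \<kappa> ys) y = fiber \<kappa> (ys @ [y])"
proof -
  have "fiber \<kappa> (zs @ [y]) = fiber \<kappa> (ys @ [y])" if "zs \<in> fiber \<kappa> ys" for zs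
  proof -
    have "\<kappa> zs = \<kappa> ys" using that by (simp add: fiber_def)
    then have "\<kappa> (zs @ [y]) = \<kappa> (ys @ [y])" using assms unfolding sufficient_def by blast
    then show ?thesis by (simp add: fiber_def)
  qed
  moreover have "ys \<in> fiber \<kappa> ys" by (simp add: fiber_def)
  ultimately have "(\<lambda>zs. fiber \<kappa> (zs @ [y])) ` fiber \<kappa> ys = {fiber \<kappa> (ys @ [y])}" by blast
  then show ?thesis by (simp add: quotient_its_def)
qed

text \<open>The common label of the members of a class.\<close>

definition class_label :: "('y list \<Rightarrow> 'l) \<Rightarrow> 'y list set \<Rightarrow> 'l" where
  "class_label \<kappa> C = the_elem (\<kappa> ` C)"

lemma class_label_fiber: "class_label \<kappa> (fiber \<kappa> ys) = \<kappa> ys"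
proof -
  have "\<kappa> ` fiber \<kappa> ys = {\<kappa> ys}" by (auto simp: fiber_def)
  then show ?thesis by (simp add: class_label_def)
qed

definition its_iso :: "('i \<Rightarrow> 'j) \<Rightarrow> ('i, 'y) its \<Rightarrow> ('j, 'y) its \<Rightarrow> bool" where
  "its_iso g S T \<longleftrightarrow>
     bij_betw g (its_states S) (its_states T) \<and>
     g (its_init S) = its_init T \<and>
     (\<forall>i\<in>its_states S. \<forall>y. g (its_step S i y) = its_step T (g i) y)"

definition reachable_part :: "('i, 'y) its \<Rightarrow> ('i, 'y) its" where
  "reachable_part S = S\<lparr>its_states := range (its_run S)\<rparr>"

lemma reachable_part_id: "its_states S = range (its_run S) \<Longrightarrow> reachable_part S = S"
  by (simp add: reachable_part_def)

text \<open>
  \<open>S\<close> is the quotient by \<open>\<kappa>\<close>, where the class of \<open>ys\<close> is identified with the state \<open>\<kappa> ys\<close> of \<open>S\<close>.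
  Every state of a quotient is reached by some observation sequence, so states of \<open>S\<close> that no
  sequence reaches are left out of the comparison; they have no influence on what \<open>S\<close> supports.
  If all states of \<open>S\<close> are reachable, \<open>reachable_part S\<close> is \<open>S\<close> itself (\<open>reachable_part_id\<close>).
\<close>

definition is_quotient_by :: "('i, 'y) its \<Rightarrow> ('y list \<Rightarrow> 'i) \<Rightarrow> bool" where
  "is_quotient_by S \<kappa> \<longleftrightarrow> its_iso (class_label \<kappa>) (quotient_its \<kappa>) (reachable_part S)"

end

theory Submission
  imports Defs
begin

text \<open>
  The only sufficient labeling of which \<open>S\<close> is the quotient is the run map of \<open>S\<close>: the isomorphism
  sends the class of \<open>ys\<close> to the label of \<open>ys\<close> and preserves the initial state and the transitions,
  so the labels obey the recursion that defines the run. Both sides of the equivalence therefore say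
  that the restriction labeling factors through the run map of \<open>S\<close>.
\<close>

lemma its_run_Nil [simp]: "its_run S [] = its_init S"
  by (simp add: its_run_def)

lemma its_run_snoc [simp]: "its_run S (ys @ [y]) = its_step S (its_run S ys) y"
  by (simp add: its_run_def)

lemma sufficient_its_run: "sufficient (its_run S)"
  by (simp add: sufficient_def)

text \<open>The fiber of \<open>\<kappa>'\<close> that contains \<open>fiber \<kappa> a\<close> may
  be given by another base point, but it contains \<open>a\<close>, so it is
  \<open>fiber \<kappa>' a\<close>. Refinement thus becomes inclusion of kernels.\<close>

lemma refines_iff: "refines \<kappa> \<kappa>' \<longleftrightarrow> (\<forall>a b. \<kappa> a = \<kappa> b \<longrightarrow> \<kappa>' a = \<kappa>' b)"
proof
  assume refines: "refines \<kappa> \<kappa>'"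
  show "\<forall>a b. \<kappa> a = \<kappa> b \<longrightarrow> \<kappa>' a = \<kappa>' b"
  proof (intro allI impI)
    fix a b
    assume eq: "\<kappa> a = \<kappa> b"
    from refines obtain c where "fiber \<kappa> a \<subseteq> fiber \<kappa>' c"
      unfolding refines_def by blast
    moreover have "a \<in> fiber \<kappa> a" "b \<in> fiber \<kappa> a"
      using eq by (simp_all add: fiber_def)
    ultimately have "a \<in> fiber \<kappa>' c" "b \<in> fiber \<kappa>' c"
      by blast+
    then show "\<kappa>' a = \<kappa>' b"
      by (simp add: fiber_def)
  qed
next
  assume "\<forall>a b. \<kappa> a = \<kappa> b \<longrightarrow> \<kappa>' a = \<kappa>' b"
  then have "fiber \<kappa> a \<subseteq> fiber \<kappa>' a" for a
    unfolding fiber_def by blast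
  then show "refines \<kappa> \<kappa>'"
    unfolding refines_def by blast
qed

lemma refines_iff_factors: "refines \<kappa> \<kappa>' \<longleftrightarrow> (\<exists>\<mu>. (\<lambda>a. \<mu> (\<kappa> a)) = \<kappa>')"
proof
  assume refines: "refines \<kappa> \<kappa>'"
  \<comment> \<open>\<open>inv \<kappa>\<close> picks a representative of each nonempty fiber, and
    \<open>\<kappa>'\<close> is constant on that fiber. Off the range of \<open>\<kappa>\<close> the
    values of \<mu> are arbitrary.\<close>
  have "\<kappa>' (inv \<kappa> (\<kappa> a)) = \<kappa>' a" for a
  proof -
    have "\<kappa> (inv \<kappa> (\<kappa> a)) = \<kappa> a"
      by (simp add: f_inv_into_f)
    with refines show ?thesis
      unfolding refines_iff by blast
  qed
  then show "\<exists>\<mu>. (\<lambda>a. \<mu> (\<kappa> a)) = \<kappa>'"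
    by (intro exI[of _ "\<lambda>i. \<kappa>' (inv \<kappa> i)"]) simp
next
  assume "\<exists>\<mu>. (\<lambda>a. \<mu> (\<kappa> a)) = \<kappa>'"
  then show "refines \<kappa> \<kappa>'"
    by (auto simp: refines_iff)
qed

lemma supports_iff_refines:
  "supports f h p S \<longleftrightarrow> refines (its_run S) (restriction_label f h p)"
  by (simp add: supports_def refines_iff_factors its_policy_def[abs_def])

text \<open>For the run map as \<open>\<kappa>\<close>, the attained labels are exactly the states
  of \<open>reachable_part S\<close>.\<close>

lemma bij_betw_class_label: "bij_betw (class_label \<kappa>) (range (fiber \<kappa>)) (range \<kappa>)"
  unfolding bij_betw_def
proof
  show "inj_on (class_label \<kappa>) (range (fiber \<kappa>))"
    \<comment> \<open>\<open>fiber\<close> stays folded at first so that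
      \<open>class_label_fiber\<close> can reduce to equal labels.\<close>
    by (auto simp: inj_on_def class_label_fiber) (auto simp: fiber_def)
  show "class_label \<kappa> ` range (fiber \<kappa>) = range \<kappa>"
    by (simp add: image_image class_label_fiber)
qed

lemma is_quotient_by_its_run: "is_quotient_by S (its_run S)"
  unfolding is_quotient_by_def its_iso_def
proof (intro conjI ballI allI)
  show "bij_betw (class_label (its_run S)) (its_states (quotient_its (its_run S)))
      (its_states (reachable_part S))"
    by (simp add: quotient_its_def reachable_part_def bij_betw_class_label)
  show "class_label (its_run S) (its_init (quotient_its (its_run S))) = its_init (reachable_part S)"
    by (simp add: quotient_its_def reachable_part_def class_label_fiber)
  fix C y
  assume "C \<in> its_states (quotient_its (its_run S))"
  then obtain ys where "C = fiber (its_run S) ys"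
    by (auto simp: quotient_its_def)
  then show "class_label (its_run S) (its_step (quotient_its (its_run S)) C y) =
      its_step (reachable_part S) (class_label (its_run S) C) y"
    by (simp add: its_step_quotient sufficient_its_run class_label_fiber reachable_part_def)
qed

lemma is_quotient_by_imp_eq_its_run:
  assumes "sufficient \<kappa>" and "is_quotient_by S \<kappa>"
  shows "\<kappa> = its_run S"
proof
  fix ys
  have init: "\<kappa> [] = its_init S"
    using assms(2)
    by (simp add: is_quotient_by_def its_iso_def quotient_its_def reachable_part_def
        class_label_fiber)
  have step: "\<kappa> (ys @ [y]) = its_step S (\<kappa> ys) y" for ys y
  proof -
    \<comment> \<open>\<open>its_iso\<close> gives compatibility with steps only on states of the
      quotient.\<close>
    have "fiber \<kappa> ys \<in> its_states (quotient_its \<kappa>)"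
      by (simp add: quotient_its_def)
    with assms(2) have "class_label \<kappa> (its_step (quotient_its \<kappa>) (fiber \<kappa> ys) y) =
        its_step (reachable_part S) (class_label \<kappa> (fiber \<kappa> ys)) y"
      unfolding is_quotient_by_def its_iso_def by blast
    then show ?thesis
      by (simp add: its_step_quotient assms(1) class_label_fiber reachable_part_def)
  qed
  show "\<kappa> ys = its_run S ys"
    by (induction ys rule: rev_induct) (simp_all add: init step)
qed

theorem theorem1:
  fixes f :: "'x \<Rightarrow> 'u \<Rightarrow> 'x"
    and h :: "'x \<Rightarrow> 'y"
    and task :: "('y, 'u) hist \<Rightarrow> bool"
    and pi_hist :: "('y, 'u) hist \<Rightarrow> 'u"
    and S :: "('i, 'y) its"
  assumes "feasible f h task pi_hist"
    and "is_its S"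
  shows "supports f h pi_hist S \<longleftrightarrow>
    (\<exists>\<kappa> :: 'y list \<Rightarrow> 'i.
       sufficient \<kappa> \<and> refines \<kappa> (restriction_label f h pi_hist) \<and> is_quotient_by S \<kappa>)"
  \<comment> \<open>Left to right the run map is the witness; right to left any such
    \<open>\<kappa>\<close> equals the run map, so its refinement property carries over.\<close>
  unfolding supports_iff_refines
  by (metis sufficient_its_run is_quotient_by_its_run is_quotient_by_imp_eq_its_run)

end
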